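(* Let $\mathcal C\subseteq\mathbb{R}^n$ be a non-empty, closed convex set, and let $F:\mathbb{R}^n\to\mathbb{R}^n$ be strongly monotone with modulus $\mu>0$ and Lipschitz continuous with Lipschitz constant $L>0$. Let $x^*$ be the solution of $\mathrm{VI}(F,\mathcal C)$ and let $\kappa_1,\kappa_2>0$. For every $\lambda\in\left(0,\frac{2\mu}{L^2}\right)$ there exists $\varepsilon>0$ such that for any $\alpha_1\in(1-\varepsilon,1)\cap(0,1)$ and any $\alpha_2>1$, the point $x^*$ is a fixed-time stable equilibrium point of the modified projected dynamical system $$\dot x=-\rho(x)\,(x-y(x)),\qquad y(x)=\mathsf P_{\mathcal C}(x-\lambda F(x)),$$ where $$\rho(x)=\begin{cases}0,& y(x)=x,\\ \kappa_1\dfrac{1}{\|x-y(x)\|^{1-\alpha_1}}+\kappa_2\dfrac{1}{\|x-y(x)\|^{1-\alpha_2}},&\text{otherwise.}\end{cases}$$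
   Context: $\mathbb{R}^n$ carries an inner product $\langle\cdot,\cdot\rangle$ with induced norm $\|\cdot\|$. $\mathsf P_{\mathcal C}(x)=\mathrm{arg\,min}_{z\in\mathcal C}\|x-z\|$ is the projection onto $\mathcal C$. $\mathrm{VI}(F,\mathcal C)$ is the variational inequality problem: find $x^*\in\mathcal C$ such that $\langle F(x^* ),x-x^*\rangle\ge0$ for all $x\in\mathcal C$. Under the stated assumptions a solution exists and is unique. $F$ is strongly monotone with modulus $\mu>0$ if $\langle F(x)-F(y),x-y\rangle\ge\mu\|x-y\|^2$ for all $x,y$; Lipschitz continuous with constant $L>0$ if $\|F(x)-F(y)\|\le L\|x-y\|$ for all $x,y$. Fixed-time stability: consider $\dot x=X(x)$ with $X:\mathbb{R}^n\to\mathbb{R}^n$ continuous and $X(\bar x)=0$ (the definition presupposes that solutions exist and are uniquely determined in forward time). The equilibrium $\bar x$ is finite-time stable if it is stable in the sense of Lyapunov and there exist a neighborhood $\mathcal N$ of $\bar x$ and a settling-time function $T:\mathcal N\setminus\{\bar x\}\to(0,\infty)$ such that for every $x(0)\in\mathcal N\setminus\{\bar x\}$ the solution satisfies $x(t)\in\mathcal N\setminus\{\bar x\}$ for all $t\in[0,T(x(0)))$ and $\lim_{t\to T(x(0))}x(t)=\bar x$. It is globally finite-time stable if this holds with $\mathcal N=\mathbb{R}^n$. It is fixed-time stable if it is globally finite-time stable and $\sup_{x(0)}T(x(0))<\infty$, the supremum being over all initial conditions in $\mathbb{R}^n$ (other than $\bar x$). *)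

theory Defs
  imports "HOL-Analysis.Analysis"
begin

definition strongly_monotone :: "real \<Rightarrow> ('a::real_inner \<Rightarrow> 'a) \<Rightarrow> bool" where
  "strongly_monotone \<mu> F \<longleftrightarrow> (\<forall>x y. (F x - F y) \<bullet> (x - y) \<ge> \<mu> * (norm (x - y))\<^sup>2)"

definition VI :: "('a::real_inner \<Rightarrow> 'a) \<Rightarrow> 'a set \<Rightarrow> 'a set" where
  "VI F C = {z \<in> C. \<forall>x\<in>C. F z \<bullet> (x - z) \<ge> 0}"

definition solves_ode_on :: "('a::real_normed_vector \<Rightarrow> 'a) \<Rightarrow> (real \<Rightarrow> 'a) \<Rightarrow> real set \<Rightarrow> bool" where
  "solves_ode_on X x I \<longleftrightarrow> (\<forall>t\<in>I. (x has_vector_derivative X (x t)) (at t within I))"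

text \<open>Every initial value has a solution on \<open>[0, \<infinity>)\<close>, and every solution on a shorter
  interval \<open>[0, \<tau>)\<close> with the same initial value coincides with it there. Global existence
  loses nothing for the global stability notions below: once a solution has reached an
  equilibrium, it can be continued by a constant.\<close>

definition forward_well_posed :: "('a::real_normed_vector \<Rightarrow> 'a) \<Rightarrow> bool" where
  "forward_well_posed X \<longleftrightarrow>
     (\<forall>x0. \<exists>x. solves_ode_on X x {0..} \<and> x 0 = x0 \<and>
        (\<forall>\<tau>>0. \<forall>z. solves_ode_on X z {0..<\<tau>} \<and> z 0 = x0 \<longrightarrow> (\<forall>t\<in>{0..<\<tau>}. z t = x t)))"

definition lyapunov_stable :: "('a::real_normed_vector \<Rightarrow> 'a) \<Rightarrow> 'a \<Rightarrow> bool" where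
  "lyapunov_stable X xbar \<longleftrightarrow>
     (\<forall>e>0. \<exists>d>0. \<forall>x. solves_ode_on X x {0..} \<and> norm (x 0 - xbar) < d \<longrightarrow>
        (\<forall>t\<ge>0. norm (x t - xbar) < e))"

definition settling_time_function ::
    "('a::real_normed_vector \<Rightarrow> 'a) \<Rightarrow> 'a \<Rightarrow> 'a set \<Rightarrow> ('a \<Rightarrow> real) \<Rightarrow> bool" where
  "settling_time_function X xbar N T \<longleftrightarrow>
     (\<forall>x0\<in>N - {xbar}. T x0 > 0) \<and>
     (\<forall>x. solves_ode_on X x {0..} \<and> x 0 \<in> N - {xbar} \<longrightarrow>
        (\<forall>t\<in>{0..<T (x 0)}. x t \<in> N - {xbar}) \<and> (x \<longlongrightarrow> xbar) (at (T (x 0))))"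

text \<open>The standing assumptions on the system (continuity, equilibrium, existence and forward
  uniqueness of solutions) are part of the notion. Without existence, the conditions quantified
  over all solutions could hold vacuously.\<close>

definition fixed_time_stable :: "('a::real_normed_vector \<Rightarrow> 'a) \<Rightarrow> 'a \<Rightarrow> bool" where
  "fixed_time_stable X xbar \<longleftrightarrow>
     continuous_on UNIV X \<and> X xbar = 0 \<and> forward_well_posed X \<and>
     lyapunov_stable X xbar \<and>
     (\<exists>T. settling_time_function X xbar UNIV T \<and> bdd_above (T ` (UNIV - {xbar})))"

definition proj_step :: "real \<Rightarrow> ('a::euclidean_space \<Rightarrow> 'a) \<Rightarrow> 'a set \<Rightarrow> 'a \<Rightarrow> 'a" where
  "proj_step lam F C x = closest_point C (x - lam *\<^sub>R F x)"

definition rho :: "real \<Rightarrow> real \<Rightarrow> real \<Rightarrow> real \<Rightarrow> real \<Rightarrow> ('a::euclidean_space \<Rightarrow> 'a) \<Rightarrow> 'a set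
    \<Rightarrow> 'a \<Rightarrow> real" where
  "rho \<kappa>1 \<kappa>2 \<alpha>1 \<alpha>2 lam F C x =
     (if proj_step lam F C x = x then 0
      else \<kappa>1 * (1 / norm (x - proj_step lam F C x) powr (1 - \<alpha>1)) +
           \<kappa>2 * (1 / norm (x - proj_step lam F C x) powr (1 - \<alpha>2)))"

definition modified_pds :: "real \<Rightarrow> real \<Rightarrow> real \<Rightarrow> real \<Rightarrow> real \<Rightarrow> ('a::euclidean_space \<Rightarrow> 'a)
    \<Rightarrow> 'a set \<Rightarrow> 'a \<Rightarrow> 'a" where
  "modified_pds \<kappa>1 \<kappa>2 \<alpha>1 \<alpha>2 lam F C x =
     - (rho \<kappa>1 \<kappa>2 \<alpha>1 \<alpha>2 lam F C x *\<^sub>R (x - proj_step lam F C x))"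

end

theory Submission
  imports Defs
begin

text \<open>
  Write \<open>g\<close> for the projection step \<open>x \<mapsto> P\<^sub>C (x - \<lambda> F x)\<close> and \<open>residual x = x - g x\<close>. For
  \<open>\<lambda> \<in> (0, 2\<mu>/L\<^sup>2)\<close> the map \<open>x \<mapsto> x - \<lambda> F x\<close> is a contraction with some constant \<open>c < 1\<close>, and projections
  are nonexpansive, so \<open>g\<close> is a contraction (\<open>proj_step_contraction\<close>); its fixed point is the solution
  of the variational inequality (\<open>proj_step_VI\<close>). From here on only the contraction property of \<open>g\<close>
  matters. It makes the residual strongly monotone and comparable in norm to the distance from the
  fixed point. The system is \<open>x' = - h(\<parallel>residual x\<parallel>) residual x\<close> with
  \<open>h s = \<kappa>\<^sub>1 s powr (\<alpha>\<^sub>1 - 1) + \<kappa>\<^sub>2 s powr (\<alpha>\<^sub>2 - 1)\<close>.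

  Settling. For \<open>p = min (1 - \<alpha>\<^sub>1) (\<alpha>\<^sub>2 - 1)\<close> the speed factor dominates a multiple of
  \<open>n powr (-p) + n powr p\<close>, where \<open>n\<close> is the distance to the fixed point. Hence
  \<open>n' \<le> - k n (n powr (-p) + n powr p)\<close>, which says exactly that \<open>arctan (n powr p)\<close> decreases at a rate of at least
  \<open>p k\<close>. As the arctangent is bounded by \<open>\<pi>/2\<close>, the fixed point is reached within a time that does not
  depend on the initial value (\<open>reaching_time_bound\<close>). This works for every \<open>\<alpha>\<^sub>1 \<in> (0,1)\<close>, so
  \<open>\<epsilon> = 1\<close> can be chosen.

  Well-posedness. The field is not Lipschitz at the fixed point, but elsewhere it is a positive multiple
  of \<open>- residual\<close>, so its trajectories are reparametrisations of solutions of \<open>y' = - residual y = g y - y\<close>.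
  The latter has a global solution, because in its variation-of-constants form
  \<open>y t = e\<^sup>-\<^sup>t x\<^sub>0 + \<integral> e\<^sup>s\<^sup>-\<^sup>t g (y s) ds\<close> the right-hand side is a \<open>c\<close>-contraction on bounded continuous
  functions (\<open>residual_curve_exists\<close>). Inverting the clock \<open>\<tau> s = \<integral> 1/speed (y s) ds\<close> gives a trajectory
  of the system until it reaches the fixed point, after which it is constant
  (\<open>trajectory_exists\<close>). Conversely, two curves that run along \<open>- residual\<close> with the same
  time-dependent speed approach each other, by monotonicity (\<open>curves_approach\<close>). So every trajectory is \<open>y\<close>
  read at the time shown by the same clock (\<open>trajectory_is_time_change\<close>), and trajectories are unique.
\<close>

section \<open>Calculus on the half-line\<close>

lemma nonincreasing_if_has_derivative_nonpos:
  fixes f :: "real \<Rightarrow> real"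
  assumes "s \<le> t" "continuous_on {s..t} f"
    and "\<And>u. s < u \<Longrightarrow> u < t \<Longrightarrow> (f has_vector_derivative f' u) (at u)"
    and "\<And>u. s < u \<Longrightarrow> u < t \<Longrightarrow> f' u \<le> 0"
  shows "f t \<le> f s"
  using DERIV_nonpos_imp_decreasing_open[of s t f] assms
  by (meson has_real_derivative_iff_has_vector_derivative)

lemma antiderivative_on_half_line:
  fixes f :: "real \<Rightarrow> 'b::banach"
  assumes "continuous_on {0..} f"
  shows "continuous_on {0..} (\<lambda>t. integral {0..t} f)"
    and "0 < t \<Longrightarrow> ((\<lambda>t. integral {0..t} f) has_vector_derivative f t) (at t)"
proof -
  have cont: "continuous_on {0..b} f" for b
    using assms by (rule continuous_on_subset) auto
  have der: "((\<lambda>t. integral {0..t} f) has_vector_derivative f t) (at t within {0..t+1})"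
    if "0 \<le> t" for t
    using that by (intro integral_has_vector_derivative cont) auto
  show "((\<lambda>t. integral {0..t} f) has_vector_derivative f t) (at t)" if "0 < t"
    using der[of t] that at_within_interior[of t "{0..t+1}"] by (simp add: interior_atLeastAtMost_real)
  show "continuous_on {0..} (\<lambda>t. integral {0..t} f)"
    unfolding continuous_on_eq_continuous_within
  proof
    fix t :: real assume t: "t \<in> {0..}"
    have "at t within {0..t+1} = at t within {0..}"
      by (rule at_within_nhd[of _ "{..<t+1}"]) auto
    with der[of t] t show "continuous (at t within {0..}) (\<lambda>t. integral {0..t} f)"
      using has_vector_derivative_continuous by force
  qed
qed

text \<open>
  At an exceptional time the derivative comes for free from the integral form: by the fundamental theorem
  of calculus with finitely many exceptions, \<open>x t = x 0 + \<integral> X (x s) ds\<close>, and the integrand is continuous.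
  This covers both the initial time and the time at which a trajectory comes to rest.\<close>
lemma solves_ode_on_if_finite_exceptions:
  fixes X :: "'a::banach \<Rightarrow> 'a"
  assumes X: "continuous_on UNIV X" and x: "continuous_on {0..} x" and "finite S"
    and der: "\<And>t. 0 < t \<Longrightarrow> t \<notin> S \<Longrightarrow> (x has_vector_derivative X (x t)) (at t)"
  shows "solves_ode_on X x {0..}"
  unfolding solves_ode_on_def
proof
  fix t :: real assume t: "t \<in> {0..}"
  have Xx: "continuous_on {0..} (\<lambda>t. X (x t))"
    by (rule continuous_on_compose2[OF X x]) auto
  have x_integral: "x 0 + integral {0..s} (\<lambda>t. X (x t)) = x s" if "s \<in> {0..t+1}" for s
  proof -
    have "((\<lambda>t. X (x t)) has_integral (x s - x 0)) {0..s}"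
      using that der
      by (intro fundamental_theorem_of_calculus_interior_strong[OF \<open>finite S\<close>]
            continuous_on_subset[OF x]) auto
    then show ?thesis by (simp add: integral_unique)
  qed
  have "((\<lambda>s. x 0 + integral {0..s} (\<lambda>t. X (x t))) has_vector_derivative 0 + X (x t))
      (at t within {0..t+1})"
    using t by (intro has_vector_derivative_add has_vector_derivative_const
        integral_has_vector_derivative continuous_on_subset[OF Xx]) auto
  then have "(x has_vector_derivative X (x t)) (at t within {0..t+1})"
    using t x_integral by (auto intro: has_vector_derivative_transform[rotated 2])
  moreover have "at t within {0..t+1} = at t within {0..}"
    by (rule at_within_nhd[of _ "{..<t+1}"]) (use t in auto)
  ultimately show "(x has_vector_derivative X (x t)) (at t within {0..})" by simp
qed

lemma first_hitting_time:
  fixes u :: "real \<Rightarrow> 'a::t1_space"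
  assumes "continuous_on {0..b} u" "0 \<le> b" "u b = a"
  obtains t where "0 \<le> t" "t \<le> b" "u t = a" "\<And>s. 0 \<le> s \<Longrightarrow> s < t \<Longrightarrow> u s \<noteq> a"
proof -
  have "closed ({0..b} \<inter> u -` {a})"
    using assms(1) by (intro continuous_closed_preimage) auto
  then have "compact ({0..b} \<inter> u -` {a})"
    by (metis compact_Int_closed compact_Icc inf_left_idem)
  moreover have "{0..b} \<inter> u -` {a} \<noteq> {}"
    using assms by auto
  ultimately obtain t where "t \<in> {0..b} \<inter> u -` {a}" "\<And>s. s \<in> {0..b} \<inter> u -` {a} \<Longrightarrow> t \<le> s"
    using compact_attains_inf by metis
  then show thesis by (intro that[of t]) force+
qed

text \<open>
  The kernel \<open>exp (u - s)\<close> has total mass \<open>1 - exp (- s) < 1\<close> on \<open>[0, s]\<close>. This keeps the integral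
  operator for \<open>y' = g y - y\<close> a contraction uniformly in time.\<close>
lemma norm_integral_exp_weighted:
  fixes k :: "real \<Rightarrow> 'b::banach"
  assumes k: "continuous_on {0..s} k" and "0 \<le> s"
    and bound: "\<And>u. norm (k u) \<le> M"
  shows "norm (exp (- s) *\<^sub>R integral {0..s} (\<lambda>u. exp u *\<^sub>R k u)) \<le> M"
proof -
  have "((\<lambda>u. M * exp u) has_integral (M * exp s - M * exp 0)) {0..s}"
    by (rule fundamental_theorem_of_calculus[OF \<open>0 \<le> s\<close>])
       (auto intro!: derivative_eq_intros simp flip: has_real_derivative_iff_has_vector_derivative)
  moreover have "norm (integral {0..s} (\<lambda>u. exp u *\<^sub>R k u)) \<le> integral {0..s} (\<lambda>u. M * exp u)"
    by (rule integral_norm_bound_integral)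
       (auto intro!: integrable_continuous_real continuous_intros k simp: bound mult.commute)
  ultimately have "norm (integral {0..s} (\<lambda>u. exp u *\<^sub>R k u)) \<le> M * exp s - M"
    by (simp only: integral_unique exp_zero mult_1_right)
  then have "exp (- s) * norm (integral {0..s} (\<lambda>u. exp u *\<^sub>R k u)) \<le> exp (- s) * (M * exp s - M)"
    by (intro mult_left_mono) auto
  also have "\<dots> = M - M * exp (- s)"
    by (simp add: algebra_simps flip: exp_add)
  also have "\<dots> \<le> M"
    using bound[of 0] by (simp add: order_trans[OF norm_ge_zero])
  finally show ?thesis by simp
qed

section \<open>Curves along the residual of a contraction\<close>

text \<open>
  A solution of \<open>w' = - q(t) r(w)\<close> on \<open>[0, b]\<close> for a prescribed, time-dependent speed \<open>q\<close>. The unit-speed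
  flow (\<open>q = 1\<close>), a trajectory of the system (\<open>q\<close> the speed along the trajectory itself) and a
  reparametrised curve are all of this form, so that they can be compared with one another.\<close>
definition curve_along :: "('a::real_normed_vector \<Rightarrow> 'a) \<Rightarrow> (real \<Rightarrow> real) \<Rightarrow> (real \<Rightarrow> 'a) \<Rightarrow> real \<Rightarrow> bool"
  where "curve_along r q w b \<longleftrightarrow> continuous_on {0..b} w \<and>
    (\<forall>t. 0 < t \<and> t < b \<longrightarrow> (w has_vector_derivative - (q t *\<^sub>R r (w t))) (at t))"

lemma curve_along_subinterval:
  "curve_along r q w b \<Longrightarrow> b' \<le> b \<Longrightarrow> curve_along r q w b'"
  unfolding curve_along_def by (auto intro: continuous_on_subset)

lemma has_vector_derivative_norm_squared:
  fixes w :: "real \<Rightarrow> 'a::real_inner"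
  assumes "(w has_vector_derivative w') (at t)"
  shows "((\<lambda>t. (norm (w t))\<^sup>2) has_vector_derivative 2 * (w' \<bullet> w t)) (at t)"
proof -
  have "((\<lambda>t. w t \<bullet> w t) has_vector_derivative w t \<bullet> w' + w' \<bullet> w t) (at t)"
    using assms unfolding has_vector_derivative_def
    by (auto intro!: derivative_eq_intros simp: algebra_simps inner_commute)
  then show ?thesis
    by (simp add: power2_norm_eq_inner inner_commute)
qed

locale contraction_map =
  fixes g :: "'a::euclidean_space \<Rightarrow> 'a" and c :: real and xbar :: 'a
  assumes c_nonneg: "0 \<le> c" and c_less_1: "c < 1"
    and contraction: "norm (g x - g y) \<le> c * norm (x - y)"
    and fixed_point: "g xbar = xbar"
begin

definition residual :: "'a \<Rightarrow> 'a" where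
  "residual x = x - g x"

text \<open>
  By the Cauchy--Schwarz inequality, \<open>g\<close> can undo at most the fraction \<open>c\<close> of \<open>x - y\<close>.\<close>
lemma residual_strongly_monotone:
  "(1 - c) * (norm (x - y))\<^sup>2 \<le> (residual x - residual y) \<bullet> (x - y)"
proof -
  have "(g x - g y) \<bullet> (x - y) \<le> norm (g x - g y) * norm (x - y)"
    by (rule norm_cauchy_schwarz)
  also have "\<dots> \<le> c * norm (x - y) * norm (x - y)"
    by (intro mult_right_mono contraction) auto
  finally have "(g x - g y) \<bullet> (x - y) \<le> c * (norm (x - y))\<^sup>2"
    by (simp add: power2_eq_square mult.assoc)
  moreover have "residual x - residual y = (x - y) - (g x - g y)"
    by (simp add: residual_def)
  ultimately show ?thesis
    by (simp only: inner_diff_left[of "x - y" "g x - g y"] power2_norm_eq_inner left_diff_distrib)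
qed

lemma residual_fixed_point [simp]: "residual xbar = 0"
  by (simp add: residual_def fixed_point)

lemma norm_residual_bounds:
  "(1 - c) * norm (x - xbar) \<le> norm (residual x)" "norm (residual x) \<le> (1 + c) * norm (x - xbar)"
proof -
  have "norm (residual x) = norm ((x - xbar) - (g x - g xbar))"
    by (simp add: residual_def fixed_point)
  then show "(1 - c) * norm (x - xbar) \<le> norm (residual x)" "norm (residual x) \<le> (1 + c) * norm (x - xbar)"
    using contraction[of x xbar] norm_triangle_ineq2[of "x - xbar" "g x - g xbar"]
      norm_triangle_ineq4[of "x - xbar" "g x - g xbar"]
    by (simp_all add: distrib_right left_diff_distrib)
qed

lemma residual_eq_0_iff: "residual x = 0 \<longleftrightarrow> x = xbar"
  using norm_residual_bounds(1)[of x] c_less_1 by (auto simp: mult_le_0_iff)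

lemma continuous_g: "continuous_on UNIV g"
  by (rule lipschitz_on_continuous_on[of c])
     (auto simp: lipschitz_on_def c_nonneg dist_norm contraction)

lemma continuous_residual: "continuous_on UNIV residual"
  unfolding residual_def by (intro continuous_intros continuous_g)

text \<open>
  The squared distance has derivative \<open>- 2 q \<langle>residual u - residual w, u - w\<rangle> \<le> 0\<close>. Since no Lipschitz bound
  on \<open>q\<close> enters, this replaces Gronwall's inequality in the uniqueness argument.\<close>
lemma curves_approach:
  assumes u: "curve_along residual q u b" and w: "curve_along residual q w b"
    and q: "\<And>t. 0 < t \<Longrightarrow> t < b \<Longrightarrow> 0 \<le> q t"
    and st: "0 \<le> s" "s \<le> t" "t \<le> b"
  shows "norm (u t - w t) \<le> norm (u s - w s)"
proof -
  have "(norm (u t - w t))\<^sup>2 \<le> (norm (u s - w s))\<^sup>2"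
  proof (rule nonincreasing_if_has_derivative_nonpos[OF \<open>s \<le> t\<close>])
    show "continuous_on {s..t} (\<lambda>t. (norm (u t - w t))\<^sup>2)"
      using u w st unfolding curve_along_def
      by (auto intro!: continuous_intros elim!: continuous_on_subset)
    fix z assume z: "s < z" "z < t"
    show "((\<lambda>t. (norm (u t - w t))\<^sup>2) has_vector_derivative
      2 * ((- (q z *\<^sub>R residual (u z)) - - (q z *\<^sub>R residual (w z))) \<bullet> (u z - w z))) (at z)"
      using u w st z unfolding curve_along_def
      by (intro has_vector_derivative_norm_squared has_vector_derivative_diff) auto
    have "0 \<le> q z * ((residual (u z) - residual (w z)) \<bullet> (u z - w z))"
      using q[of z] z st c_less_1
      by (intro mult_nonneg_nonneg order_trans[OF _ residual_strongly_monotone]) auto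
    then show "2 * ((- (q z *\<^sub>R residual (u z)) - - (q z *\<^sub>R residual (w z))) \<bullet> (u z - w z)) \<le> 0"
      by (simp add: inner_diff_left algebra_simps)
  qed
  then show ?thesis by (rule power2_le_imp_le) auto
qed

lemma curve_along_fixed_point: "curve_along residual q (\<lambda>_. xbar) b"
  by (simp add: curve_along_def)

lemma curve_norm_nonincreasing:
  assumes "curve_along residual q u b"
    and "\<And>t. 0 < t \<Longrightarrow> t < b \<Longrightarrow> 0 \<le> q t"
    and "0 \<le> s" "s \<le> t" "t \<le> b"
  shows "norm (u t - xbar) \<le> norm (u s - xbar)"
  by (rule curves_approach[OF assms(1) curve_along_fixed_point assms(2-)])

text \<open>
  At unit speed the squared distance \<open>v\<close> to the fixed point satisfies \<open>- 2 (1 + c) v \<le> v' \<le> - 2 (1 - c) v\<close>.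
  The upper bound gives convergence; the lower bound shows that the fixed point is not reached at any
  finite time.\<close>
lemma residual_curve_bounds:
  assumes y: "curve_along residual (\<lambda>_. 1) y b" and "0 \<le> b"
  shows "(norm (y b - xbar))\<^sup>2 \<le> (norm (y 0 - xbar))\<^sup>2 * exp (- (2 * (1 - c) * b))"
    and "(norm (y 0 - xbar))\<^sup>2 * exp (- (2 * (1 + c) * b)) \<le> (norm (y b - xbar))\<^sup>2"
proof -
  define v where "v t = (norm (y t - xbar))\<^sup>2" for t
  have cont: "continuous_on {0..b} v"
    using y unfolding curve_along_def v_def by (auto intro!: continuous_intros)
  define v' where "v' t = - 2 * (residual (y t) \<bullet> (y t - xbar))" for t
  have der: "(v has_vector_derivative v' t) (at t)" if "0 < t" "t < b" for t
  proof -
    have "(v has_vector_derivative 2 * ((- (1 *\<^sub>R residual (y t)) - 0) \<bullet> (y t - xbar))) (at t)"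
      using y that unfolding curve_along_def v_def
      by (intro has_vector_derivative_norm_squared has_vector_derivative_diff) auto
    then show ?thesis by (simp add: v'_def)
  qed
  have weighted: "((\<lambda>t. v t * exp (k * t)) has_vector_derivative (v' t + k * v t) * exp (k * t)) (at t)"
    if "0 < t" "t < b" for t k
    using der[OF that] unfolding has_real_derivative_iff_has_vector_derivative[symmetric]
    by (auto intro!: derivative_eq_intros simp: algebra_simps)
  have upper: "v' t + (2 * (1 - c)) * v t \<le> 0" for t
    using residual_strongly_monotone[of "y t" xbar] by (simp add: v_def v'_def algebra_simps)
  have lower: "0 \<le> v' t + 2 * (1 + c) * v t" for t
  proof -
    have "residual (y t) \<bullet> (y t - xbar) \<le> norm (residual (y t)) * norm (y t - xbar)"
      by (rule norm_cauchy_schwarz)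
    also have "\<dots> \<le> (1 + c) * norm (y t - xbar) * norm (y t - xbar)"
      by (intro mult_right_mono norm_residual_bounds) auto
    finally show ?thesis by (simp add: v_def v'_def power2_eq_square algebra_simps)
  qed
  have "v b * exp ((2 * (1 - c)) * b) \<le> v 0 * exp ((2 * (1 - c)) * 0)"
    by (rule nonincreasing_if_has_derivative_nonpos[OF \<open>0 \<le> b\<close> _ weighted])
       (auto intro!: continuous_intros cont mult_nonpos_nonneg upper simp del: right_diff_distrib_numeral)
  then show "(norm (y b - xbar))\<^sup>2 \<le> (norm (y 0 - xbar))\<^sup>2 * exp (- (2 * (1 - c) * b))"
    by (simp add: v_def exp_minus pos_le_divide_eq flip: divide_inverse)
  have "- (v b * exp ((2 * (1 + c)) * b)) \<le> - (v 0 * exp ((2 * (1 + c)) * 0))"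
    by (rule nonincreasing_if_has_derivative_nonpos[OF \<open>0 \<le> b\<close> _ has_vector_derivative_minus[OF weighted]])
       (auto intro!: continuous_intros cont lower mult_nonneg_nonneg simp del: distrib_left_numeral)
  then show "(norm (y 0 - xbar))\<^sup>2 * exp (- (2 * (1 + c) * b)) \<le> (norm (y b - xbar))\<^sup>2"
    by (simp add: v_def exp_minus pos_divide_le_eq flip: divide_inverse)
qed


text \<open>
  Picard iteration on bounded continuous functions. Separating the linear part of \<open>y' = - y + g y\<close> makes
  the integral operator a contraction with constant \<open>c\<close> for the supremum norm over the whole half-line,
  so that a single fixed point is already a global solution.\<close>
lemma residual_curve_exists:
  obtains y where "continuous_on {0..} y" "y 0 = x0" "\<And>b. curve_along residual (\<lambda>_. 1) y b"
proof -
  define J where "J f s = exp (- s) *\<^sub>R (x0 + integral {0..s} (\<lambda>u. exp u *\<^sub>R g (f u)))"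
    for f :: "real \<Rightarrow> 'a" and s
  have gf: "continuous_on S (\<lambda>u. g (apply_bcontfun f u))" for f :: "real \<Rightarrow>\<^sub>C 'a" and S
    by (rule continuous_on_compose2[OF continuous_g]) auto
  have J_cont: "continuous_on {0..} (J f)" for f :: "real \<Rightarrow>\<^sub>C 'a"
    unfolding J_def by (intro continuous_intros antiderivative_on_half_line gf)
  have in_bcontfun: "(\<lambda>t. J f (max 0 t)) \<in> bcontfun" for f :: "real \<Rightarrow>\<^sub>C 'a"
  proof -
    obtain B where B: "\<And>u. norm (f u) \<le> B"
      using bounded_apply_bcontfun[of f] by (auto simp: bounded_iff)
    have M: "norm (g (f u)) \<le> norm xbar + c * (B + norm xbar)" for u
    proof -
      have "norm (g (f u)) \<le> norm xbar + norm (g (f u) - g xbar)"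
        using norm_triangle_sub[of "g (f u)" xbar] by (simp add: fixed_point)
      also have "\<dots> \<le> norm xbar + c * norm (f u - xbar)"
        by (simp add: contraction)
      also have "\<dots> \<le> norm xbar + c * (B + norm xbar)"
        using B[of u] norm_triangle_ineq4[of "f u" xbar] by (intro add_left_mono mult_left_mono c_nonneg) auto
      finally show ?thesis .
    qed
    have "norm (J f s) \<le> norm x0 + (norm xbar + c * (B + norm xbar))" if "0 \<le> s" for s
    proof -
      have "norm (J f s) \<le> norm (exp (- s) *\<^sub>R x0)
          + norm (exp (- s) *\<^sub>R integral {0..s} (\<lambda>u. exp u *\<^sub>R g (f u)))"
        unfolding J_def scaleR_add_right by (rule norm_triangle_ineq)
      also have "\<dots> \<le> 1 * norm x0 + (norm xbar + c * (B + norm xbar))"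
        using that by (intro add_mono norm_integral_exp_weighted gf M)
          (auto intro!: mult_left_le_one_le)
      finally show ?thesis by simp
    qed
    then have "bounded (range (\<lambda>t. J f (max 0 t)))"
      unfolding bounded_iff by (intro exI[of _ "norm x0 + (norm xbar + c * (B + norm xbar))"]) auto
    moreover have "continuous_on UNIV (\<lambda>t. J f (max 0 t))"
      by (rule continuous_on_compose2[OF J_cont]) (auto intro!: continuous_intros)
    ultimately show ?thesis by (simp add: bcontfun_def)
  qed
  \<comment> \<open>Functions on the half-line become functions on the whole line by freezing them at negative times.\<close>
  define \<Phi> :: "(real \<Rightarrow>\<^sub>C 'a) \<Rightarrow> (real \<Rightarrow>\<^sub>C 'a)" where "\<Phi> f = Bcontfun (\<lambda>t. J f (max 0 t))" for f
  have \<Phi>: "apply_bcontfun (\<Phi> f) t = J f (max 0 t)" for f t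
    by (simp add: \<Phi>_def Bcontfun_inverse[OF in_bcontfun])
  have "dist (\<Phi> f1) (\<Phi> f2) \<le> c * dist f1 f2" for f1 f2
  proof (rule dist_bound)
    fix t :: real
    define s where "s = max 0 t"
    have integrable: "(\<lambda>u. exp u *\<^sub>R g (apply_bcontfun f u)) integrable_on {0..s}" for f :: "real \<Rightarrow>\<^sub>C 'a"
      by (intro integrable_continuous_real continuous_intros gf)
    have "J f1 s - J f2 s = exp (- s) *\<^sub>R integral {0..s} (\<lambda>u. exp u *\<^sub>R (g (f1 u) - g (f2 u)))"
      unfolding J_def scaleR_diff_right integral_diff[OF integrable integrable]
      by (simp add: algebra_simps)
    moreover have "norm (g (f1 u) - g (f2 u)) \<le> c * dist f1 f2" for u
      using contraction[of "f1 u" "f2 u"] dist_bounded[of f1 u f2] c_nonneg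
      by (metis dist_norm mult_left_mono order_trans)
    then have "norm (exp (- s) *\<^sub>R integral {0..s} (\<lambda>u. exp u *\<^sub>R (g (f1 u) - g (f2 u))))
        \<le> c * dist f1 f2"
      by (intro norm_integral_exp_weighted continuous_intros gf) (auto simp: s_def)
    ultimately have "norm (J f1 s - J f2 s) \<le> c * dist f1 f2"
      by simp
    then show "dist (\<Phi> f1 t) (\<Phi> f2 t) \<le> c * dist f1 f2"
      by (simp add: \<Phi> dist_norm s_def)
  qed
  then obtain f where "\<Phi> f = f"
    using banach_fix_type[OF c_nonneg c_less_1, of \<Phi>] by auto
  then have f: "f t = J f t" if "0 \<le> t" for t
    using \<Phi>[of f t] that by simp
  have der: "(f has_vector_derivative - (1 *\<^sub>R residual (f t))) (at t)" if "0 < t" for t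
  proof -
    have "((\<lambda>s. exp (- s) *\<^sub>R (x0 + integral {0..s} (\<lambda>u. exp u *\<^sub>R g (f u)))) has_vector_derivative
        exp (- t) *\<^sub>R (0 + exp t *\<^sub>R g (f t))
          + (- exp (- t)) *\<^sub>R (x0 + integral {0..t} (\<lambda>u. exp u *\<^sub>R g (f u)))) (at t)"
      by (intro has_vector_derivative_scaleR has_vector_derivative_add has_vector_derivative_const
          antiderivative_on_half_line continuous_intros gf that)
         (auto intro!: derivative_eq_intros)
    also have "exp (- t) *\<^sub>R (0 + exp t *\<^sub>R g (f t))
          + (- exp (- t)) *\<^sub>R (x0 + integral {0..t} (\<lambda>u. exp u *\<^sub>R g (f u)))
        = g (f t) - J f t"
      by (simp add: J_def flip: exp_add)
    also have "\<dots> = - (1 *\<^sub>R residual (f t))"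
      using f[of t] that by (simp add: residual_def)
    finally have "(J f has_vector_derivative - (1 *\<^sub>R residual (f t))) (at t)"
      unfolding J_def .
    then show ?thesis
      by (rule has_vector_derivative_transform_within_open[of _ _ _ "{0<..}"]) (use that f in auto)
  qed
  show thesis
  proof
    show "f 0 = x0" using f[of 0] by (simp add: J_def)
  qed (auto simp: curve_along_def intro: der[simplified])
qed

end


section \<open>Fixed-time attraction\<close>

text \<open>
  The requirements on the speed profile \<open>h\<close>: the limit makes the vector field continuous at the fixed point,
  where \<open>h\<close> itself may blow up; the lower bound has the term \<open>s powr - p\<close> to force arrival in finite time
  and the term \<open>s powr p\<close> to bound this time independently of the initial distance. The value \<open>h 0\<close> is only ever multiplied
  by the zero residual; its sign makes the speed nonnegative everywhere.\<close>
locale fixed_time_flow = contraction_map +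
  fixes h :: "real \<Rightarrow> real" and m p :: real
  assumes h_continuous: "continuous_on {0<..} h"
    and h_limit: "((\<lambda>s. h s * s) \<longlongrightarrow> 0) (at_right 0)"
    and h_0: "0 \<le> h 0"
    and h_lower: "\<And>s. 0 < s \<Longrightarrow> m * (s powr - p + s powr p) \<le> h s"
    and m_pos: "0 < m" and p_pos: "0 < p"
begin

definition speed :: "'a \<Rightarrow> real" where
  "speed x = h (norm (residual x))"

definition field :: "'a \<Rightarrow> 'a" where
  "field x = - (speed x *\<^sub>R residual x)"

lemma field_fixed_point: "field xbar = 0"
  by (simp add: field_def)

text \<open>
  The norm of the residual lies between \<open>(1 - c) n\<close> and \<open>(1 + c) n \<le> n / (1 - c)\<close>, where \<open>n\<close> is the distance
  to the fixed point. Replacing it by \<open>n\<close> thus costs the same factor \<open>(1 - c) powr p\<close> in both powers.\<close>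
lemma speed_lower:
  assumes "x \<noteq> xbar"
  shows "m * (1 - c) powr p * (norm (x - xbar) powr - p + norm (x - xbar) powr p) \<le> speed x"
proof -
  define n s where "n = norm (x - xbar)" and "s = norm (residual x)"
  have n: "0 < n" using assms by (simp add: n_def)
  have c: "0 < 1 - c" using c_less_1 by simp
  have lower: "(1 - c) * n \<le> s" using norm_residual_bounds(1)[of x] by (simp add: n_def s_def)
  have s: "0 < s" using lower n c by (smt (verit) mult_pos_pos)
  have "(1 - c) * s \<le> (1 - c) * ((1 + c) * n)"
    using norm_residual_bounds(2)[of x] c by (intro mult_left_mono) (auto simp: n_def s_def)
  also have "\<dots> = (1 - c\<^sup>2) * n" by (simp add: power2_eq_square algebra_simps)
  also have "\<dots> \<le> 1 * n" using n by (intro mult_right_mono) auto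
  finally have upper: "(1 - c) * s \<le> n" by simp
  have "(1 - c) powr p * n powr p \<le> s powr p"
    using lower n c p_pos by (auto simp: intro: powr_mono2 simp flip: powr_mult)
  moreover have "(1 - c) powr p * n powr - p \<le> s powr - p"
  proof -
    have "(1 - c) powr p * s powr p \<le> n powr p"
      using upper s c p_pos by (auto simp: intro: powr_mono2 simp flip: powr_mult)
    then show ?thesis using n s by (simp add: powr_minus field_simps)
  qed
  ultimately have "m * ((1 - c) powr p * (n powr - p + n powr p)) \<le> m * (s powr - p + s powr p)"
    using m_pos by (intro mult_left_mono) (auto simp: distrib_left)
  also have "\<dots> \<le> speed x"
    using h_lower[OF s] by (simp add: speed_def s_def)
  finally show ?thesis by (simp add: n_def mult.assoc)
qed

lemma speed_pos: "x \<noteq> xbar \<Longrightarrow> 0 < speed x"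
  using c_less_1 m_pos
  by (intro less_le_trans[OF _ speed_lower] mult_pos_pos add_pos_pos) auto

lemma speed_nonneg: "0 \<le> speed x"
  using speed_pos[of x] h_0 by (cases "x = xbar") (auto simp: speed_def)

lemma continuous_speed: "continuous_on (- {xbar}) speed"
  unfolding speed_def
  by (rule continuous_on_compose2[OF h_continuous])
     (auto intro!: continuous_intros continuous_on_subset[OF continuous_residual] simp: residual_eq_0_iff)

lemma continuous_field: "continuous_on UNIV field"
proof -
  have "isCont field x" if "x \<noteq> xbar" for x
  proof -
    have "continuous_on (- {xbar}) field"
      unfolding field_def
      by (intro continuous_intros continuous_speed continuous_on_subset[OF continuous_residual]) auto
    then show ?thesis
      using that by (simp add: continuous_on_eq_continuous_at open_Compl)
  qed
  moreover have "isCont field xbar"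
  proof -
    have "(residual \<longlongrightarrow> 0) (at xbar)"
      using continuous_residual residual_fixed_point
      by (metis UNIV_I continuous_on_eq_continuous_at isCont_def open_UNIV)
    then have "filterlim (\<lambda>x. norm (residual x)) (at_right 0) (at xbar)"
      by (auto simp: filterlim_at eventually_at_filter residual_eq_0_iff intro!: tendsto_norm_zero)
    from filterlim_compose[OF h_limit this]
    have "((\<lambda>x. norm (field x)) \<longlongrightarrow> 0) (at xbar)"
      by (simp add: field_def speed_nonneg flip: speed_def)
    then show ?thesis
      by (simp add: isCont_def field_fixed_point tendsto_norm_zero_cancel)
  qed
  ultimately show ?thesis
    by (metis continuous_at_imp_continuous_on)
qed

abbreviation trajectory :: "(real \<Rightarrow> 'a) \<Rightarrow> real \<Rightarrow> bool" where
  "trajectory x b \<equiv> curve_along residual (\<lambda>t. speed (x t)) x b"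

lemma trajectory_if_solves_ode_on:
  assumes "solves_ode_on field x I" "{0..b} \<subseteq> I"
  shows "trajectory x b"
  unfolding curve_along_def
proof (intro conjI allI impI)
  have x: "(x has_vector_derivative field (x t)) (at t within I)" if "t \<in> I" for t
    using assms(1) that by (simp add: solves_ode_on_def)
  have "continuous_on I x"
    by (rule continuous_on_vector_derivative[OF x])
  then show "continuous_on {0..b} x"
    using assms(2) by (rule continuous_on_subset)
  fix t assume t: "0 < t \<and> t < b"
  have "{0<..<b} \<subseteq> I"
    using greaterThanLessThan_subseteq_atLeastAtMost_iff[of 0 b 0 b] assms(2) by (meson order_refl subset_trans)
  then have "t \<in> interior I"
    using t by (meson greaterThanLessThan_iff interiorI open_greaterThanLessThan)
  moreover from this have "t \<in> I"
    by (rule subsetD[OF interior_subset])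
  ultimately show "(x has_vector_derivative - (speed (x t) *\<^sub>R residual (x t))) (at t)"
    using x[of t] at_within_interior[of t I] by (simp add: field_def)
qed

lemma trajectory_norm_nonincreasing:
  assumes "trajectory x b" "0 \<le> s" "s \<le> t" "t \<le> b"
  shows "norm (x t - xbar) \<le> norm (x s - xbar)"
  by (rule curve_norm_nonincreasing[OF assms(1) speed_nonneg assms(2-4)])

lemma trajectory_stays_at_fixed_point:
  assumes "trajectory x b" "0 \<le> s" "s \<le> t" "t \<le> b" "x s = xbar"
  shows "x t = xbar"
  using trajectory_norm_nonincreasing[OF assms(1-4)] assms(5) by simp

definition decay_rate :: real where
  "decay_rate = p * (1 - c) * (m * (1 - c) powr p)"

lemma decay_rate_pos: "0 < decay_rate"
  using p_pos m_pos c_less_1 by (simp add: decay_rate_def)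

text \<open>
  With \<open>z = (norm (x t - xbar)) powr p\<close>, the bound on the speed has the factor \<open>1 / z + z = (1 + z\<^sup>2) / z\<close>, whose
  numerator cancels the denominator of the derivative of \<open>arctan z\<close>. So \<open>arctan z + decay_rate * t\<close> is
  nonincreasing, starts below \<open>\<pi> / 2\<close> and is at least \<open>decay_rate * t\<close>.\<close>
lemma reaching_time_bound:
  assumes x: "trajectory x b" and "0 \<le> b" and "x b \<noteq> xbar"
  shows "decay_rate * b \<le> pi / 2"
proof -
  define v where "v t = (norm (x t - xbar))\<^sup>2" for t
  define v' where "v' t = - 2 * speed (x t) * (residual (x t) \<bullet> (x t - xbar))" for t
  define E where "E t = arctan (v t powr (p / 2))" for t
  have away: "x t \<noteq> xbar" if "0 \<le> t" "t \<le> b" for t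
    using trajectory_stays_at_fixed_point[OF x that(1,2)] assms(3) by auto
  have v_pos: "0 < v t" if "0 \<le> t" "t \<le> b" for t
    using away[OF that] by (simp add: v_def)
  have v_cont: "continuous_on {0..b} v"
    using x unfolding curve_along_def v_def by (auto intro!: continuous_intros)
  have v_der: "(v has_real_derivative v' t) (at t)" if "0 < t" "t < b" for t
  proof -
    have "(v has_vector_derivative
        2 * ((- (speed (x t) *\<^sub>R residual (x t)) - 0) \<bullet> (x t - xbar))) (at t)"
      using x that unfolding curve_along_def v_def
      by (intro has_vector_derivative_norm_squared has_vector_derivative_diff) auto
    then show ?thesis by (simp add: v'_def mult.assoc has_real_derivative_iff_has_vector_derivative)
  qed
  have E_der: "(E has_real_derivative
      inverse (1 + (v t powr (p / 2))\<^sup>2) * (p / 2 * v t powr (p / 2 - 1) * v' t)) (at t)"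
    if "0 < t" "t < b" for t
    unfolding E_def using that
    by (intro DERIV_chain2[OF DERIV_arctan] DERIV_chain2[OF has_real_derivative_powr] v_der v_pos) auto
  have decay: "inverse (1 + (v t powr (p / 2))\<^sup>2) * (p / 2 * v t powr (p / 2 - 1) * v' t) \<le> - decay_rate"
    if "0 < t" "t < b" for t
  proof -
    define z where "z = v t powr (p / 2)"
    have vt: "0 < v t" using v_pos that by simp
    have z: "0 < z" using vt by (simp add: z_def)
    have "v t = norm (x t - xbar) powr 2"
      using away[of t] that by (simp add: v_def)
    then have zn: "z = norm (x t - xbar) powr p"
      by (simp only: z_def powr_powr) simp
    have "m * (1 - c) powr p * (1 / z + z) \<le> speed (x t)"
      using speed_lower[OF away[of t]] that by (simp add: zn powr_minus_divide)
    moreover have "(1 - c) * v t \<le> residual (x t) \<bullet> (x t - xbar)"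
      using residual_strongly_monotone[of "x t" xbar] by (simp add: v_def)
    ultimately have "m * (1 - c) powr p * (1 / z + z) * ((1 - c) * v t)
        \<le> speed (x t) * (residual (x t) \<bullet> (x t - xbar))"
      using vt c_less_1 speed_nonneg[of "x t"] by (intro mult_mono) auto
    then have "v' t \<le> - 2 * (m * (1 - c) powr p * (1 / z + z) * ((1 - c) * v t))"
      by (simp add: v'_def)
    \<comment> \<open>The factor \<open>v t\<close> in the bound on \<open>v' t\<close> cancels the denominator that comes from differentiating the power.\<close>
    have cancel: "p / 2 * (z / w) * (- 2 * (K * B * ((1 - c) * w))) = - (z * B) * (p * (1 - c) * K)"
      if "w \<noteq> 0" for K B w :: real
      using that by (simp add: field_simps)
    from \<open>v' t \<le> _\<close> have "inverse (1 + z\<^sup>2) * (p / 2 * (z / v t) * v' t)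
        \<le> inverse (1 + z\<^sup>2) * (p / 2 * (z / v t) * (- 2 * (m * (1 - c) powr p * (1 / z + z) * ((1 - c) * v t))))"
      using z vt p_pos by (intro mult_left_mono) auto
    also have "\<dots> = inverse (1 + z\<^sup>2) * (- (z * (1 / z + z)) * decay_rate)"
      using vt by (subst cancel) (auto simp: decay_rate_def)
    also have "z * (1 / z + z) = 1 + z\<^sup>2"
      using z by (simp add: power2_eq_square distrib_left)
    also have "inverse (1 + z\<^sup>2) * (- (1 + z\<^sup>2) * decay_rate)
        = - (inverse (1 + z\<^sup>2) * (1 + z\<^sup>2)) * decay_rate"
      by (simp only: mult_minus_left mult_minus_right mult.assoc)
    also have "inverse (1 + z\<^sup>2) * (1 + z\<^sup>2) = 1"
      by (rule left_inverse) (smt (verit) zero_le_power2)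
    finally show ?thesis using vt by (simp add: z_def[symmetric] powr_diff)
  qed
  have "E b + decay_rate * b \<le> E 0 + decay_rate * 0"
  proof (rule nonincreasing_if_has_derivative_nonpos[OF \<open>0 \<le> b\<close>])
    show "continuous_on {0..b} (\<lambda>t. E t + decay_rate * t)"
      unfolding E_def using v_pos by (intro continuous_intros v_cont) force
    fix t assume "0 < t" "t < b"
    then show "((\<lambda>t. E t + decay_rate * t) has_vector_derivative
        inverse (1 + (v t powr (p / 2))\<^sup>2) * (p / 2 * v t powr (p / 2 - 1) * v' t) + decay_rate) (at t)"
      unfolding has_real_derivative_iff_has_vector_derivative[symmetric]
      by (auto intro!: derivative_eq_intros E_der)
  qed (use decay in force)
  moreover have "0 \<le> E b" "E 0 < pi / 2"
    unfolding E_def by (auto simp: zero_le_arctan_iff intro: arctan_ubound simp del: less_divide_eq_numeral1)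
  ultimately show ?thesis by simp
qed


section \<open>Existence and uniqueness by a change of time\<close>

text \<open>
  \<open>\<tau> s\<close> is the time that the system needs to travel along \<open>y\<close> from \<open>y 0\<close> to \<open>y s\<close>. The integrand is
  continuous because \<open>y\<close> avoids the fixed point, the only place where the speed can be discontinuous.\<close>
lemma residual_curve_with_clock:
  assumes "x0 \<noteq> xbar"
  obtains y \<tau> where "continuous_on {0..} y" "y 0 = x0" "\<And>b. curve_along residual (\<lambda>_. 1) y b"
    "\<And>s. 0 \<le> s \<Longrightarrow> y s \<noteq> xbar"
    "continuous_on {0..} \<tau>" "\<tau> 0 = 0"
    "\<And>s. 0 < s \<Longrightarrow> (\<tau> has_real_derivative 1 / speed (y s)) (at s)"
    "strict_mono_on {0..} \<tau>"
proof -
  obtain y where y: "continuous_on {0..} y" "y 0 = x0" "\<And>b. curve_along residual (\<lambda>_. 1) y b"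
    using residual_curve_exists[of x0] by metis
  have away: "y s \<noteq> xbar" if "0 \<le> s" for s
  proof -
    have "0 < (norm (y 0 - xbar))\<^sup>2 * exp (- (2 * (1 + c) * s))"
      using assms y(2) by simp
    also have "\<dots> \<le> (norm (y s - xbar))\<^sup>2"
      by (rule residual_curve_bounds(2)[OF y(3) that])
    finally show ?thesis by auto
  qed
  define \<tau> where "\<tau> s = integral {0..s} (\<lambda>s. 1 / speed (y s))" for s
  have "continuous_on {0..} (\<lambda>s. speed (y s))"
    by (rule continuous_on_compose2[OF continuous_speed y(1)]) (use away in auto)
  then have "continuous_on {0..} (\<lambda>s. 1 / speed (y s))"
    using away speed_pos by (intro continuous_intros) (auto simp: less_imp_neq[symmetric])
  note \<tau> = antiderivative_on_half_line[OF this, folded \<tau>_def]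
  have \<tau>_der: "(\<tau> has_real_derivative 1 / speed (y s)) (at s)" if "0 < s" for s
    using \<tau>(2)[OF that] by (simp add: \<tau>_def[abs_def] has_real_derivative_iff_has_vector_derivative)
  have "strict_mono_on {0..} \<tau>"
  proof (rule strict_mono_onI)
    fix s t :: real assume st: "s \<in> {0..}" "t \<in> {0..}" "s < t"
    show "\<tau> s < \<tau> t"
    proof (rule DERIV_pos_imp_increasing_open[OF \<open>s < t\<close>])
      show "continuous_on {s..t} \<tau>"
        by (rule continuous_on_subset[OF \<tau>(1)]) (use st in auto)
      show "\<exists>d. (\<tau> has_real_derivative d) (at u) \<and> 0 < d" if "s < u" "u < t" for u
        using \<tau>_der[of u] speed_pos[OF away[of u]] st that by auto
    qed
  qed
  with y away \<tau>(1) \<tau>_der show thesis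
    by (intro that[of y \<tau>]) (auto simp: \<tau>_def)
qed

text \<open>
  Let \<open>\<sigma>\<close> be the integral of the speed along \<open>u\<close>. Then \<open>u\<close> and \<open>y \<circ> \<sigma>\<close> run along the residual with the same
  speed from the same point, so \<open>curves_approach\<close> makes them equal. Hence \<open>\<sigma>' = speed (y \<circ> \<sigma>)\<close>, which makes \<open>\<sigma>\<close> the
  inverse of the clock \<open>\<tau>\<close>.\<close>
lemma trajectory_is_time_change:
  assumes y: "continuous_on {0..} y" "\<And>b. curve_along residual (\<lambda>_. 1) y b"
    and \<tau>: "continuous_on {0..} \<tau>" "\<tau> 0 = 0"
      "\<And>s. 0 < s \<Longrightarrow> (\<tau> has_real_derivative 1 / speed (y s)) (at s)"
    and u: "trajectory u b" "u 0 = y 0" "u b \<noteq> xbar" and "0 \<le> b"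
  obtains s where "0 \<le> s" "\<tau> s = b" "y s = u b"
proof (cases "b = 0")
  case True
  with that[of 0] \<tau>(2) u(2) show ?thesis by simp
next
  case False
  with \<open>0 \<le> b\<close> have b: "0 < b" by simp
  have away: "u t \<noteq> xbar" if "0 \<le> t" "t \<le> b" for t
    using trajectory_stays_at_fixed_point[OF u(1) that(1,2)] u(3) by auto
  have away': "u (min b t) \<noteq> xbar" if "0 \<le> t" for t
    using away[of "min b t"] that b by simp
  \<comment> \<open>The speed is frozen after \<open>b\<close> to have a continuous function on the whole half-line.\<close>
  define q where "q t = speed (u (min b t))" for t
  define \<sigma> where "\<sigma> t = integral {0..t} q" for t
  have u_cont: "continuous_on {0..b} u" using u(1) by (simp add: curve_along_def)
  have "continuous_on {0..} (\<lambda>t. u (min b t))"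
    by (rule continuous_on_compose2[OF u_cont]) (use b in \<open>auto intro!: continuous_intros\<close>)
  then have "continuous_on {0..} q"
    unfolding q_def using away' by (intro continuous_on_compose2[OF continuous_speed]) auto
  note \<sigma>' = antiderivative_on_half_line[OF this, folded \<sigma>_def]
  have q_pos: "0 < q t" if "0 \<le> t" for t
    using speed_pos[OF away'[OF that]] by (simp add: q_def)
  have \<sigma>_der: "(\<sigma> has_vector_derivative q t) (at t)" if "0 < t" for t
    using \<sigma>'(2)[OF that] by (simp add: \<sigma>_def[abs_def])
  have \<sigma>_cont: "continuous_on {0..b} \<sigma>"
    by (rule continuous_on_subset[OF \<sigma>'(1)]) auto
  have \<sigma>_0: "\<sigma> 0 = 0" by (simp add: \<sigma>_def)
  have \<sigma>_pos: "0 < \<sigma> t" if "0 < t" for t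
  proof -
    have "\<sigma> 0 < \<sigma> t"
    proof (rule DERIV_pos_imp_increasing_open[OF that])
      show "continuous_on {0..t} \<sigma>"
        by (rule continuous_on_subset[OF \<sigma>'(1)]) auto
      show "\<exists>d. (\<sigma> has_real_derivative d) (at z) \<and> 0 < d" if "0 < z" "z < t" for z
        using \<sigma>_der[of z] q_pos[of z] that by (auto simp: has_real_derivative_iff_has_vector_derivative)
    qed
    then show ?thesis by (simp add: \<sigma>_0)
  qed
  have \<sigma>_nonneg: "0 \<le> \<sigma> t" if "0 \<le> t" for t
    using \<sigma>_pos[of t] \<sigma>_0 that by (cases "t = 0") auto
  have w: "curve_along residual q (\<lambda>t. y (\<sigma> t)) b"
    unfolding curve_along_def
  proof (intro conjI allI impI)
    show "continuous_on {0..b} (\<lambda>t. y (\<sigma> t))"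
      by (rule continuous_on_compose2[OF y(1) \<sigma>_cont]) (auto simp: \<sigma>_nonneg)
    fix t assume "0 < t \<and> t < b"
    then have t: "0 < t" "t < b" by auto
    have "(y has_vector_derivative - (1 *\<^sub>R residual (y (\<sigma> t)))) (at (\<sigma> t))"
      using y(2)[of "\<sigma> t + 1"] \<sigma>_pos[OF t(1)] unfolding curve_along_def by auto
    from vector_diff_chain_at[OF \<sigma>_der[OF t(1)] this]
    show "((\<lambda>t. y (\<sigma> t)) has_vector_derivative - (q t *\<^sub>R residual (y (\<sigma> t)))) (at t)"
      by (simp add: o_def)
  qed
  have "curve_along residual q u b"
    using u(1) by (auto simp: curve_along_def q_def min_def)
  from curves_approach[OF this w less_imp_le[OF q_pos]]
  have u_eq: "u t = y (\<sigma> t)" if "0 \<le> t" "t \<le> b" for t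
    using that u(2) by (force simp: \<sigma>_0)
  have "\<tau> (\<sigma> b) - b = \<tau> (\<sigma> 0) - 0"
  proof (rule DERIV_isconst_end[OF b, of "\<lambda>t. \<tau> (\<sigma> t) - t"])
    show "continuous_on {0..b} (\<lambda>t. \<tau> (\<sigma> t) - t)"
      by (intro continuous_intros continuous_on_compose2[OF \<tau>(1) \<sigma>_cont]) (auto simp: \<sigma>_nonneg)
    fix t assume t: "0 < t" "t < b"
    have "((\<lambda>t. \<tau> (\<sigma> t) - t) has_real_derivative 1 / speed (y (\<sigma> t)) * q t - 1) (at t)"
      using \<sigma>_der[OF t(1)] \<sigma>_pos[OF t(1)]
      by (intro DERIV_diff DERIV_ident DERIV_chain2[OF \<tau>(3)])
         (auto simp: has_real_derivative_iff_has_vector_derivative)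
    then show "((\<lambda>t. \<tau> (\<sigma> t) - t) has_real_derivative 0) (at t)"
      using u_eq[of t] t q_pos[of t] by (simp add: q_def min_def)
  qed
  then show ?thesis
    using that[of "\<sigma> b"] \<sigma>_nonneg \<open>0 \<le> b\<close> u_eq[of b] by (simp add: \<sigma>_0 \<tau>(2))
qed

lemma trajectories_equal_off_fixed_point:
  assumes u: "trajectory u b" "u b \<noteq> xbar" and v: "trajectory v b" "v b \<noteq> xbar"
    and "u 0 = v 0" "0 \<le> b"
  shows "u b = v b"
proof -
  have "u 0 \<noteq> xbar"
    using trajectory_stays_at_fixed_point[OF u(1), of 0 b] u(2) \<open>0 \<le> b\<close> by auto
  then obtain y \<tau> where y: "continuous_on {0..} y" "y 0 = u 0" "\<And>b. curve_along residual (\<lambda>_. 1) y b"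
    and \<tau>: "continuous_on {0..} \<tau>" "\<tau> 0 = 0"
      "\<And>s. 0 < s \<Longrightarrow> (\<tau> has_real_derivative 1 / speed (y s)) (at s)" "strict_mono_on {0..} \<tau>"
    using residual_curve_with_clock by metis
  obtain s where s: "0 \<le> s" "\<tau> s = b" "y s = u b"
    using trajectory_is_time_change[OF y(1,3) \<tau>(1-3) u(1) y(2)[symmetric] u(2) \<open>0 \<le> b\<close>] .
  obtain s' where s': "0 \<le> s'" "\<tau> s' = b" "y s' = v b"
    using trajectory_is_time_change[OF y(1,3) \<tau>(1-3) v(1) _ v(2) \<open>0 \<le> b\<close>] y(2) \<open>u 0 = v 0\<close> by metis
  have "s = s'"
    using strict_mono_on_eqD[OF \<tau>(4), of s s'] s s' by auto
  with s s' show ?thesis by simp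
qed

text \<open>
  Up to the time at which \<open>u\<close> first hits the fixed point, a trajectory \<open>v\<close> that is still away from it at
  time \<open>b\<close> agrees with \<open>u\<close>. By continuity \<open>v\<close> is then at the fixed point at that time as well, which is absurd
  because a trajectory does not leave the fixed point.\<close>
lemma trajectories_reach_together:
  assumes u: "trajectory u b" "u b = xbar" and v: "trajectory v b"
    and "u 0 = v 0" "0 \<le> b"
  shows "v b = xbar"
proof (rule ccontr)
  assume v_b: "v b \<noteq> xbar"
  have away: "v t \<noteq> xbar" if "0 \<le> t" "t \<le> b" for t
    using trajectory_stays_at_fixed_point[OF v that(1,2)] v_b by auto
  have cont: "continuous_on {0..b} u" "continuous_on {0..b} v"
    using u(1) v by (auto simp: curve_along_def)
  obtain t where t: "0 \<le> t" "t \<le> b" "u t = xbar" "\<And>s. 0 \<le> s \<Longrightarrow> s < t \<Longrightarrow> u s \<noteq> xbar"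
    using first_hitting_time[OF cont(1) \<open>0 \<le> b\<close> u(2)] by metis
  have "t \<noteq> 0" using t(3) away[of 0] \<open>u 0 = v 0\<close> \<open>0 \<le> b\<close> by auto
  with t(1) have "0 < t" by simp
  have before: "u s = v s" if "0 \<le> s" "s < t" for s
  proof (rule trajectories_equal_off_fixed_point[of u s v])
    show "trajectory u s" "trajectory v s"
      using that t(2) by (auto intro: curve_along_subinterval[OF u(1)] curve_along_subinterval[OF v])
  qed (use that t away[of s] \<open>u 0 = v 0\<close> in auto)
  have "((\<lambda>s. u s - v s) \<longlongrightarrow> u t - v t) (at t within {0..b})"
    using cont t by (intro tendsto_diff) (auto simp: continuous_on_def)
  then have "((\<lambda>s. u s - v s) \<longlongrightarrow> u t - v t) (at t within {0..<t})"
    by (rule tendsto_within_subset) (use t in auto)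
  moreover have "((\<lambda>s. u s - v s) \<longlongrightarrow> 0) (at t within {0..<t})"
    by (rule tendsto_eventually) (auto simp: eventually_at_filter before)
  moreover have "at t within {0..<t} \<noteq> bot"
    using \<open>0 < t\<close> by (simp add: at_within_eq_bot_iff closure_atLeastLessThan)
  ultimately have "u t - v t = 0"
    using tendsto_unique by blast
  with t away[of t] show False by auto
qed

lemma trajectory_unique:
  assumes "trajectory u b" "trajectory v b" "u 0 = v 0" "0 \<le> b"
  shows "u b = v b"
proof (cases "u b = xbar \<or> v b = xbar")
  case True
  then show ?thesis
    using trajectories_reach_together[OF assms(1) _ assms(2-4)]
      trajectories_reach_together[OF assms(2) _ assms(1) assms(3)[symmetric] assms(4)] by metis
next
  case False
  then show ?thesis
    using trajectories_equal_off_fixed_point[OF assms(1) _ assms(2) _ assms(3,4)] by blast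
qed


text \<open>
  The trajectory is \<open>y \<circ> \<theta>\<close> with \<open>\<theta>\<close> the inverse of the clock, followed by rest at the fixed point. By
  \<open>reaching_time_bound\<close> the clock is bounded, so its supremum \<open>T\<close> is the time of arrival. The initial time
  and \<open>T\<close> are the only times at which differentiability is not evident, and \<open>solves_ode_on_if_finite_exceptions\<close> takes
  care of both.\<close>
lemma trajectory_exists:
  assumes "x0 \<noteq> xbar"
  obtains x where "solves_ode_on field x {0..}" "x 0 = x0"
proof -
  obtain y \<tau> where y: "continuous_on {0..} y" "y 0 = x0" "\<And>b. curve_along residual (\<lambda>_. 1) y b"
      "\<And>s. 0 \<le> s \<Longrightarrow> y s \<noteq> xbar"
    and \<tau>: "continuous_on {0..} \<tau>" "\<tau> 0 = 0"
      "\<And>s. 0 < s \<Longrightarrow> (\<tau> has_real_derivative 1 / speed (y s)) (at s)" "strict_mono_on {0..} \<tau>"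
    using residual_curve_with_clock[OF assms] by metis
  have \<tau>_less_iff: "\<tau> s < \<tau> t \<longleftrightarrow> s < t" if "0 \<le> s" "0 \<le> t" for s t
    using strict_mono_on_less[OF \<tau>(4)] that by auto
  have \<tau>_inj: "inj_on \<tau> {0..}"
    by (rule strict_mono_on_imp_inj_on[OF \<tau>(4)])
  define \<theta> where "\<theta> = the_inv_into {0..} \<tau>"
  have \<theta>\<tau>: "\<theta> (\<tau> s) = s" if "0 \<le> s" for s
    using that by (simp add: \<theta>_def the_inv_into_f_f[OF \<tau>_inj])
  have \<tau>_image: "\<tau> ` {0..b} = {0..\<tau> b}" if "0 \<le> b" for b
  proof
    show "\<tau> ` {0..b} \<subseteq> {0..\<tau> b}"
      using \<tau>_less_iff that \<tau>(2) by (force simp flip: not_less)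
    show "{0..\<tau> b} \<subseteq> \<tau> ` {0..b}"
    proof
      fix t assume "t \<in> {0..\<tau> b}"
      then show "t \<in> \<tau> ` {0..b}"
        using IVT'[of \<tau> 0 t b] continuous_on_subset[OF \<tau>(1), of "{0..b}"] that \<tau>(2) by force
    qed
  qed
  have \<theta>_cont: "continuous_on {0..\<tau> b} \<theta>" if "0 \<le> b" for b
    using continuous_on_inv[of "{0..b}" \<tau> \<theta>] continuous_on_subset[OF \<tau>(1), of "{0..b}"] that
    by (simp add: \<theta>\<tau> \<tau>_image)
  have moving: "trajectory (\<lambda>t. y (\<theta> t)) (\<tau> b)" if "0 \<le> b" for b
    unfolding curve_along_def
  proof (intro conjI allI impI)
    have \<theta>_range: "\<theta> t \<in> {0..b} \<and> \<tau> (\<theta> t) = t" if "t \<in> {0..\<tau> b}" for t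
      using that \<theta>\<tau> unfolding \<tau>_image[OF \<open>0 \<le> b\<close>, symmetric] by auto
    show "continuous_on {0..\<tau> b} (\<lambda>t. y (\<theta> t))"
      by (rule continuous_on_compose2[OF y(1) \<theta>_cont[OF that]]) (use \<theta>_range in auto)
    fix t assume t: "0 < t \<and> t < \<tau> b"
    have \<theta>_pos: "0 < \<theta> t"
      using \<theta>_range[of t] t \<tau>(2) by (cases "\<theta> t = 0") auto
    have "isCont \<theta> t"
      using \<theta>_cont[OF that] t by (simp add: continuous_on_interior interior_atLeastAtMost_real)
    then have "(\<theta> has_real_derivative inverse (1 / speed (y (\<theta> t)))) (at t)"
      using t \<theta>_pos \<theta>_range speed_pos[OF y(4)[of "\<theta> t"]]
      by (intro DERIV_inverse_function[where f = \<tau> and a = 0 and b = "\<tau> b"] \<tau>(3)) auto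
    then have "(\<theta> has_vector_derivative speed (y (\<theta> t))) (at t)"
      by (simp add: has_real_derivative_iff_has_vector_derivative)
    moreover have "(y has_vector_derivative - (1 *\<^sub>R residual (y (\<theta> t)))) (at (\<theta> t))"
      using y(3)[of "\<theta> t + 1"] \<theta>_pos unfolding curve_along_def by auto
    ultimately show "((\<lambda>t. y (\<theta> t)) has_vector_derivative
        - (speed (y (\<theta> t)) *\<^sub>R residual (y (\<theta> t)))) (at t)"
      using vector_diff_chain_at by (fastforce simp: o_def)
  qed
  have \<tau>_bound: "\<tau> b \<le> pi / 2 / decay_rate" if "0 \<le> b" for b
  proof -
    have "0 \<le> \<tau> b" using \<tau>_image[OF that] that by auto
    with reaching_time_bound[OF moving[OF that]] y(4)[OF that] decay_rate_pos
    show ?thesis by (simp add: \<theta>\<tau>[OF that] pos_le_divide_eq mult.commute)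
  qed
  define T where "T = (SUP s\<in>{0..}. \<tau> s)"
  have bdd: "bdd_above (\<tau> ` {0..})" using \<tau>_bound by (auto intro!: bdd_aboveI2)
  have before_T: "\<tau> s < T" if "0 \<le> s" for s
  proof -
    have "\<tau> s < \<tau> (s + 1)" using \<tau>_less_iff that by simp
    also have "\<dots> \<le> T" unfolding T_def using that by (intro cSUP_upper bdd) auto
    finally show ?thesis .
  qed
  have reached: "\<exists>b\<ge>0. t < \<tau> b" if "t < T" for t
    using that less_cSUP_iff[OF _ bdd, of t] by (auto simp: T_def)
  define x where "x t = (if t < T then y (\<theta> t) else xbar)" for t
  have x_eq: "x t = y (\<theta> t)" if "0 \<le> b" "t \<le> \<tau> b" for t b
    using before_T[OF that(1)] that(2) by (simp add: x_def)
  \<comment> \<open>Monotonicity of the distance turns \<open>y s \<rightarrow> xbar\<close> into continuity of \<open>x\<close> at \<open>T\<close>.\<close>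
  have x_near: "norm (x t - xbar) \<le> norm (y s - xbar)" if "0 \<le> s" "\<tau> s \<le> t" for s t
  proof (cases "t < T")
    case True
    then obtain b where b: "0 \<le> b" "t < \<tau> b" using reached by blast
    have "0 \<le> \<tau> s" using \<tau>_image[OF that(1)] that by auto
    with trajectory_norm_nonincreasing[OF moving[OF b(1)], of "\<tau> s" t] b that True
    show ?thesis by (simp add: x_def \<theta>\<tau>)
  qed (simp add: x_def)
  have y_limit: "\<exists>s\<ge>0. norm (y s - xbar) < e" if "0 < e" for e
  proof -
    have "((\<lambda>s. (norm (y 0 - xbar))\<^sup>2 * exp (- (2 * (1 - c) * s))) \<longlongrightarrow> (norm (y 0 - xbar))\<^sup>2 * 0) at_top"
      by (intro tendsto_intros filterlim_compose[OF exp_at_bot]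
          filterlim_compose[OF filterlim_uminus_at_bot_at_top]
          filterlim_tendsto_pos_mult_at_top[OF tendsto_const] filterlim_ident) (use c_less_1 in auto)
    then have "eventually (\<lambda>s. (norm (y 0 - xbar))\<^sup>2 * exp (- (2 * (1 - c) * s)) < e\<^sup>2) at_top"
      using that by (intro order_tendstoD(2)) auto
    then obtain s where s: "0 \<le> s" "(norm (y 0 - xbar))\<^sup>2 * exp (- (2 * (1 - c) * s)) < e\<^sup>2"
      by (metis eventually_at_top_linorder nle_le)
    with residual_curve_bounds(1)[OF y(3), of s] have "(norm (y s - xbar))\<^sup>2 < e\<^sup>2" by simp
    then show ?thesis using s(1) that by (auto dest: power2_less_imp_less)
  qed
  have x_cont: "continuous_on {0..} x"
    unfolding continuous_on_eq_continuous_within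
  proof
    fix t :: real assume t: "t \<in> {0..}"
    show "continuous (at t within {0..}) x"
    proof (cases "t < T")
      case True
      then obtain b where b: "0 \<le> b" "t < \<tau> b" using reached by blast
      have "continuous_on {0..\<tau> b} x"
        using moving[OF b(1)] x_eq[OF b(1)] unfolding curve_along_def
        by (metis (no_types, lifting) atLeastAtMost_iff continuous_on_cong)
      then have "continuous (at t within {0..\<tau> b}) x"
        using b t by (simp add: continuous_on_eq_continuous_within)
      moreover have "at t within {0..\<tau> b} = at t within {0..}"
        by (rule at_within_nhd[of _ "{..<\<tau> b}"]) (use b in auto)
      ultimately show ?thesis by simp
    next
      case False
      have "(x \<longlongrightarrow> xbar) (at t within {0..})"
      proof (rule tendstoI)
        fix e :: real assume "0 < e"
        then obtain s where s: "0 \<le> s" "norm (y s - xbar) < e" using y_limit by blast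
        have "eventually (\<lambda>t'. \<tau> s < t') (at t within {0..})"
          using before_T[OF s(1)] False by (intro order_tendstoD(1)[OF tendsto_ident_at]) auto
        then show "eventually (\<lambda>t'. dist (x t') xbar < e) (at t within {0..})"
          by eventually_elim (simp add: dist_norm le_less_trans[OF x_near[OF s(1) less_imp_le] s(2)])
      qed
      then show ?thesis using False by (simp add: continuous_within x_def)
    qed
  qed
  have x_der: "(x has_vector_derivative field (x t)) (at t)" if "0 < t" "t \<notin> {T}" for t
  proof (cases "t < T")
    case True
    then obtain b where b: "0 \<le> b" "t < \<tau> b" using reached by blast
    have "((\<lambda>t. y (\<theta> t)) has_vector_derivative field (x t)) (at t)"
      using moving[OF b(1)] b that x_eq[OF b(1), of t] by (simp add: curve_along_def field_def)
    then show ?thesis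
      by (rule has_vector_derivative_transform_within_open[of _ _ _ "{..<\<tau> b}"])
         (use b x_eq[OF b(1)] in auto)
  next
    case False
    have "((\<lambda>_. xbar) has_vector_derivative field (x t)) (at t)"
      using False by (simp add: x_def field_fixed_point)
    then show ?thesis
      by (rule has_vector_derivative_transform_within_open[of _ _ _ "{T<..}"])
         (use False that in \<open>auto simp: x_def\<close>)
  qed
  have "x 0 = x0"
    using x_eq[of 0 0] \<theta>\<tau>[of 0] \<tau>(2) y(2) by simp
  moreover have "solves_ode_on field x {0..}"
    by (rule solves_ode_on_if_finite_exceptions[OF continuous_field x_cont _ x_der, of "{T}"]) auto
  ultimately show thesis using that by blast
qed

lemma forward_well_posed_field: "forward_well_posed field"
  unfolding forward_well_posed_def
proof
  fix x0
  obtain x where x: "solves_ode_on field x {0..}" "x 0 = x0"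
  proof (cases "x0 = xbar")
    case True
    then show thesis
      by (intro that[of "\<lambda>_. xbar"]) (auto simp: solves_ode_on_def field_fixed_point)
  qed (use trajectory_exists in blast)
  have "z t = x t" if z: "solves_ode_on field z {0..<\<tau>}" "z 0 = x0" and t: "t \<in> {0..<\<tau>}" for \<tau> z t
  proof (rule trajectory_unique[of z t x])
    show "trajectory z t" by (rule trajectory_if_solves_ode_on[OF z(1)]) (use t in auto)
    show "trajectory x t" by (rule trajectory_if_solves_ode_on[OF x(1)]) auto
  qed (use z x t in auto)
  with x show "\<exists>x. solves_ode_on field x {0..} \<and> x 0 = x0 \<and>
      (\<forall>\<tau>>0. \<forall>z. solves_ode_on field z {0..<\<tau>} \<and> z 0 = x0 \<longrightarrow> (\<forall>t\<in>{0..<\<tau>}. z t = x t))"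
    by blast
qed

lemma lyapunov_stable_field: "lyapunov_stable field xbar"
  unfolding lyapunov_stable_def
proof (intro allI impI exI conjI)
  fix e :: real and x and t :: real
  assume "0 < e" "solves_ode_on field x {0..} \<and> norm (x 0 - xbar) < e" "0 \<le> t"
  then show "norm (x t - xbar) < e"
    using trajectory_norm_nonincreasing[of x t 0 t] trajectory_if_solves_ode_on[of x "{0..}" t]
    by (auto simp: le_less_trans)
qed

text \<open>
  Every trajectory has arrived at the time \<open>pi / 2 / decay_rate + 1\<close>, which is strictly beyond the bound of
  \<open>reaching_time_bound\<close>. By uniqueness the first arrival time is the same for all solutions with the same
  initial value.\<close>
lemma settling_time_exists:
  assumes "x0 \<noteq> xbar"
  shows "\<exists>T. 0 < T \<and> T \<le> pi / 2 / decay_rate + 1 \<and>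
    (\<forall>x. solves_ode_on field x {0..} \<and> x 0 = x0 \<longrightarrow> (\<forall>t\<in>{0..<T}. x t \<noteq> xbar) \<and> x T = xbar)"
proof -
  define b where "b = pi / 2 / decay_rate + 1"
  have b: "0 < b" "pi / 2 < decay_rate * b"
    using decay_rate_pos by (auto simp: b_def field_simps add_pos_pos)
  have traj: "trajectory x t" if "solves_ode_on field x {0..}" for x t
    by (rule trajectory_if_solves_ode_on[OF that]) auto
  obtain x where x: "solves_ode_on field x {0..}" "x 0 = x0"
    using trajectory_exists[OF assms] by metis
  have "x b = xbar"
    using reaching_time_bound[OF traj[OF x(1), of b]] b by force
  moreover have "continuous_on {0..b} x"
    using traj[OF x(1), of b] by (simp add: curve_along_def)
  ultimately obtain T where T: "0 \<le> T" "T \<le> b" "x T = xbar" "\<And>s. 0 \<le> s \<Longrightarrow> s < T \<Longrightarrow> x s \<noteq> xbar"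
    using first_hitting_time[of b x xbar] b by (metis less_imp_le)
  have "T \<noteq> 0" using T(3) x(2) assms by auto
  moreover have "z t = x t" if "solves_ode_on field z {0..}" "z 0 = x0" "0 \<le> t" for z t
    using trajectory_unique[OF traj[OF that(1), of t] traj[OF x(1), of t]] x(2) that by simp
  ultimately show ?thesis
    using T by (intro exI[of _ T]) (auto simp: b_def)
qed

theorem fixed_time_stable_field: "fixed_time_stable field xbar"
proof -
  obtain T where T: "\<And>x0. x0 \<noteq> xbar \<Longrightarrow> 0 < T x0" "\<And>x0. x0 \<noteq> xbar \<Longrightarrow> T x0 \<le> pi / 2 / decay_rate + 1"
    "\<And>x t. solves_ode_on field x {0..} \<Longrightarrow> x 0 \<noteq> xbar \<Longrightarrow> t \<in> {0..<T (x 0)} \<Longrightarrow> x t \<noteq> xbar"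
    "\<And>x. solves_ode_on field x {0..} \<Longrightarrow> x 0 \<noteq> xbar \<Longrightarrow> x (T (x 0)) = xbar"
    using settling_time_exists by metis
  have "(x \<longlongrightarrow> xbar) (at (T (x 0)))" if x: "solves_ode_on field x {0..}" "x 0 \<noteq> xbar" for x
  proof -
    have "continuous_on {0..T (x 0) + 1} x"
      using trajectory_if_solves_ode_on[OF x(1), of "T (x 0) + 1"] by (simp add: curve_along_def)
    then have "isCont x (T (x 0))"
      using T(1)[OF x(2)] by (simp add: continuous_on_interior interior_atLeastAtMost_real)
    then show ?thesis using T(4)[OF x] by (simp add: isCont_def)
  qed
  with T have "settling_time_function field xbar UNIV T"
    unfolding settling_time_function_def by auto
  moreover have "bdd_above (T ` (UNIV - {xbar}))"
    using T(2) by (auto intro!: bdd_aboveI2)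
  ultimately show ?thesis
    unfolding fixed_time_stable_def
    using continuous_field field_fixed_point forward_well_posed_field lyapunov_stable_field by blast
qed

end


section \<open>The projected dynamical system\<close>

text \<open>
  Expanding the square, \<open>\<parallel>(x - \<lambda> F x) - (y - \<lambda> F y)\<parallel>\<^sup>2 \<le> (1 - 2 \<lambda> \<mu> + \<lambda>\<^sup>2 L\<^sup>2) \<parallel>x - y\<parallel>\<^sup>2\<close>. The maximum with \<open>0\<close>
  keeps the square root nonnegative without a separate proof that \<open>\<mu> \<le> L\<close>.\<close>
lemma proj_step_contraction:
  fixes F :: "'a::euclidean_space \<Rightarrow> 'a"
  assumes C: "C \<noteq> {}" "closed C" "convex C"
    and F: "strongly_monotone \<mu> F" "L-lipschitz_on UNIV F" and "0 \<le> lam"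
  shows "norm (proj_step lam F C x - proj_step lam F C y)
    \<le> sqrt (max 0 (1 - lam * (2 * \<mu> - lam * L\<^sup>2))) * norm (x - y)"
proof -
  have "norm (F x - F y) \<le> L * norm (x - y)"
    using lipschitz_onD[OF F(2), of x y] by (simp add: dist_norm)
  then have "(norm (F x - F y))\<^sup>2 \<le> (L * norm (x - y))\<^sup>2"
    by (intro power_mono) auto
  then have lip: "lam\<^sup>2 * (norm (F x - F y))\<^sup>2 \<le> lam\<^sup>2 * (L\<^sup>2 * (norm (x - y))\<^sup>2)"
    by (intro mult_left_mono) (auto simp: power_mult_distrib)
  have mono: "2 * lam * (\<mu> * (norm (x - y))\<^sup>2) \<le> 2 * lam * ((F x - F y) \<bullet> (x - y))"
    using F(1) \<open>0 \<le> lam\<close> unfolding strongly_monotone_def by (intro mult_left_mono) auto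
  have "(norm ((x - lam *\<^sub>R F x) - (y - lam *\<^sub>R F y)))\<^sup>2 = (norm ((x - y) - lam *\<^sub>R (F x - F y)))\<^sup>2"
    by (simp add: algebra_simps)
  also have "\<dots> = (norm (x - y))\<^sup>2 - 2 * lam * ((F x - F y) \<bullet> (x - y)) + lam\<^sup>2 * (norm (F x - F y))\<^sup>2"
    unfolding power2_norm_eq_inner by (simp add: inner_diff inner_commute power2_eq_square algebra_simps)
  also have "\<dots> \<le> (1 - lam * (2 * \<mu> - lam * L\<^sup>2)) * (norm (x - y))\<^sup>2"
    using lip mono by (simp add: power2_eq_square algebra_simps)
  also have "\<dots> \<le> max 0 (1 - lam * (2 * \<mu> - lam * L\<^sup>2)) * (norm (x - y))\<^sup>2"
    by (intro mult_right_mono) auto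
  finally have "norm ((x - lam *\<^sub>R F x) - (y - lam *\<^sub>R F y))
      \<le> sqrt (max 0 (1 - lam * (2 * \<mu> - lam * L\<^sup>2))) * norm (x - y)"
    by (metis norm_ge_zero real_le_rsqrt real_sqrt_abs abs_norm_cancel real_sqrt_mult)
  then show ?thesis
    using closest_point_lipschitz[OF C(3,2,1), of "x - lam *\<^sub>R F x" "y - lam *\<^sub>R F y"]
    by (simp add: proj_step_def dist_norm)
qed

text \<open>
  The variational inequality states that \<open>- F z\<close> is normal to \<open>C\<close> at \<open>z\<close>, so moving from \<open>z\<close> along it does not
  change the projection.\<close>
lemma proj_step_VI:
  fixes F :: "'a::euclidean_space \<Rightarrow> 'a"
  assumes C: "closed C" "convex C" and z: "z \<in> VI F C" and "0 \<le> lam"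
  shows "proj_step lam F C z = z"
proof -
  have "dist (z - lam *\<^sub>R F z) z \<le> dist (z - lam *\<^sub>R F z) w" if "w \<in> C" for w
  proof -
    have "0 \<le> lam * (F z \<bullet> (w - z))"
      using z that \<open>0 \<le> lam\<close> by (auto simp: VI_def)
    moreover have "(norm ((w - z) + lam *\<^sub>R F z))\<^sup>2
        = (norm (w - z))\<^sup>2 + 2 * (lam * (F z \<bullet> (w - z))) + (norm (lam *\<^sub>R F z))\<^sup>2"
      unfolding power2_norm_eq_inner by (simp add: inner_add inner_commute)
    ultimately have "(norm (lam *\<^sub>R F z))\<^sup>2 \<le> (norm ((w - z) + lam *\<^sub>R F z))\<^sup>2"
      by simp
    then have "norm (lam *\<^sub>R F z) \<le> norm ((w - z) + lam *\<^sub>R F z)"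
      by (rule power2_le_imp_le) auto
    moreover have "dist (z - lam *\<^sub>R F z) w = norm ((w - z) + lam *\<^sub>R F z)"
      by (subst dist_commute) (simp add: dist_norm algebra_simps)
    ultimately show ?thesis by (simp add: dist_norm)
  qed
  then show ?thesis
    using z closest_point_unique[OF C(2,1), of z "z - lam *\<^sub>R F z"]
    by (auto simp: proj_step_def VI_def)
qed

text \<open>
  For \<open>s \<le> 1\<close> the first power alone gives the lower bound on the speed profile, for \<open>s \<ge> 1\<close> the second one does. As
  \<open>p\<close> is the smaller of \<open>1 - \<alpha>1\<close> and \<open>\<alpha>2 - 1\<close>, each dominates \<open>s powr - p\<close> and \<open>s powr p\<close> in its range.\<close>
lemma fixed_time_flow_powers:
  assumes "contraction_map g c xbar" and "0 < \<kappa>1" "0 < \<kappa>2" and \<alpha>: "0 < \<alpha>1" "\<alpha>1 < 1" "1 < \<alpha>2"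
  shows "fixed_time_flow g c xbar
    (\<lambda>s. \<kappa>1 * (1 / s powr (1 - \<alpha>1)) + \<kappa>2 * (1 / s powr (1 - \<alpha>2)))
    (min \<kappa>1 \<kappa>2 / 2) (min (1 - \<alpha>1) (\<alpha>2 - 1))"
proof (intro fixed_time_flow.intro fixed_time_flow_axioms.intro)
  let ?h = "\<lambda>s :: real. \<kappa>1 * (1 / s powr (1 - \<alpha>1)) + \<kappa>2 * (1 / s powr (1 - \<alpha>2))"
  let ?p = "min (1 - \<alpha>1) (\<alpha>2 - 1)"
  have h_alt: "?h s = \<kappa>1 * s powr (\<alpha>1 - 1) + \<kappa>2 * s powr (\<alpha>2 - 1)" for s
    using powr_minus_divide[of s "1 - \<alpha>1"] powr_minus_divide[of s "1 - \<alpha>2"] by simp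
  show "continuous_on {0<..} ?h"
    by (intro continuous_intros) auto
  have "((\<lambda>s. \<kappa>1 * s powr \<alpha>1 + \<kappa>2 * s powr \<alpha>2) \<longlongrightarrow> \<kappa>1 * 0 powr \<alpha>1 + \<kappa>2 * 0 powr \<alpha>2) (at_right (0::real))"
    using \<alpha> by (intro tendsto_intros) (auto simp: eventually_at_filter)
  then have "((\<lambda>s. \<kappa>1 * s powr \<alpha>1 + \<kappa>2 * s powr \<alpha>2) \<longlongrightarrow> 0) (at_right (0::real))"
    by simp
  then show "((\<lambda>s. ?h s * s) \<longlongrightarrow> 0) (at_right 0)"
  proof (rule Lim_transform_eventually)
    have "\<kappa>1 * s powr \<alpha>1 + \<kappa>2 * s powr \<alpha>2 = ?h s * s" if "0 < s" for s
      using that unfolding h_alt by (simp add: distrib_right powr_diff)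
    then show "\<forall>\<^sub>F s in at_right 0. \<kappa>1 * s powr \<alpha>1 + \<kappa>2 * s powr \<alpha>2 = ?h s * s"
      by (auto simp: eventually_at_filter)
  qed
  show "0 \<le> ?h 0" by simp
  show "min \<kappa>1 \<kappa>2 / 2 * (s powr - ?p + s powr ?p) \<le> ?h s" if "0 < s" for s
  proof (cases "s \<le> 1")
    case True
    have "s powr ?p \<le> s powr - ?p" "s powr - ?p \<le> s powr (\<alpha>1 - 1)"
      using True that \<alpha> by (auto intro!: powr_mono')
    then have "min \<kappa>1 \<kappa>2 / 2 * (s powr - ?p + s powr ?p) \<le> \<kappa>1 / 2 * (s powr (\<alpha>1 - 1) + s powr (\<alpha>1 - 1))"
      using assms by (intro mult_mono add_mono) auto
    also have "\<dots> \<le> ?h s"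
      unfolding h_alt using assms by simp
    finally show ?thesis .
  next
    case False
    have "s powr - ?p \<le> s powr ?p" "s powr ?p \<le> s powr (\<alpha>2 - 1)"
      using False that \<alpha> by (auto intro!: powr_mono)
    then have "min \<kappa>1 \<kappa>2 / 2 * (s powr - ?p + s powr ?p) \<le> \<kappa>2 / 2 * (s powr (\<alpha>2 - 1) + s powr (\<alpha>2 - 1))"
      using assms by (intro mult_mono add_mono) auto
    also have "\<dots> \<le> ?h s"
      unfolding h_alt using assms by simp
    finally show ?thesis .
  qed
qed (use assms in auto)

theorem corollary1:
  fixes C :: "'a::euclidean_space set" and F :: "'a \<Rightarrow> 'a"
    and \<mu> L \<kappa>1 \<kappa>2 :: real and xstar :: 'a
  assumes "C \<noteq> {}" and "closed C" and "convex C"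
    and "\<mu> > 0" and "strongly_monotone \<mu> F"
    and "L > 0" and "L-lipschitz_on UNIV F"
    and "xstar \<in> VI F C"
    and "\<kappa>1 > 0" and "\<kappa>2 > 0"
  shows "\<forall>lam\<in>{0<..<2 * \<mu> / L\<^sup>2}. \<exists>\<epsilon>>0. \<forall>\<alpha>1\<in>{1 - \<epsilon><..<1} \<inter> {0<..<1}. \<forall>\<alpha>2>1.
           fixed_time_stable (modified_pds \<kappa>1 \<kappa>2 \<alpha>1 \<alpha>2 lam F C) xstar"
proof (intro ballI exI[of _ 1] conjI allI impI)
  fix lam \<alpha>1 \<alpha>2 :: real
  assume lam: "lam \<in> {0<..<2 * \<mu> / L\<^sup>2}" and \<alpha>1: "\<alpha>1 \<in> {1 - 1<..<1} \<inter> {0<..<1}" and \<alpha>2: "1 < \<alpha>2"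
  define c where "c = sqrt (max 0 (1 - lam * (2 * \<mu> - lam * L\<^sup>2)))"
  have "0 < 2 * \<mu> - lam * L\<^sup>2"
    using lam \<open>L > 0\<close> by (simp add: pos_less_divide_eq)
  then have "0 < lam * (2 * \<mu> - lam * L\<^sup>2)"
    using lam by simp
  then have "contraction_map (proj_step lam F C) c xstar"
    using assms lam
    by unfold_locales (auto simp: c_def intro!: proj_step_contraction proj_step_VI)
  then interpret fixed_time_flow "proj_step lam F C" c xstar
    "\<lambda>s. \<kappa>1 * (1 / s powr (1 - \<alpha>1)) + \<kappa>2 * (1 / s powr (1 - \<alpha>2))"
    "min \<kappa>1 \<kappa>2 / 2" "min (1 - \<alpha>1) (\<alpha>2 - 1)"
    using assms \<alpha>1 \<alpha>2 by (intro fixed_time_flow_powers) auto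
  have "modified_pds \<kappa>1 \<kappa>2 \<alpha>1 \<alpha>2 lam F C = field"
    unfolding modified_pds_def rho_def field_def speed_def residual_def by (rule ext) simp
  then show "fixed_time_stable (modified_pds \<kappa>1 \<kappa>2 \<alpha>1 \<alpha>2 lam F C) xstar"
    using fixed_time_stable_field by simp
qed simp

end
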